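(* Assume that one evaluation of $f$ costs $T_f=O(1)$ queries. Then the query complexity of the problem $LREC2$ on $n\times n$ maps (given $f:\{0,\dots,n-1\}\times\{0,\dots,n-1\}\to\{0,1\}$ whose empty areas are rectangles, and parameters $1\le h,w\le n$, find an empty rectangle of the largest area among those of height at least $h$ and width at least $w$), in the worst case over all instances $(f,h,w)$ with given $n$, is $\Omega(n^2)$ in the classical (deterministic or randomized) case and $\Omega(n)$ in the quantum case.
   Context: Given $f:\{0,\dots,n-1\}^2\to\{0,1\}$, a quadruple $(x_1,y_1,x_2,y_2)$ with $0\le x_1\le x_2\le n-1$ and $0\le y_1\le y_2\le n-1$ is an empty rectangle if $f(i,j)=0$ for all $x_1\le i\le x_2$, $y_1\le j\le y_2$. Its width is $x_2-x_1+1$, its height is $y_2-y_1+1$, and its size (area) is $(x_2-x_1+1)(y_2-y_1+1)$. The empty areas of $f$ are rectangles if for every $(i,j)$: $f(i,j)=0$ iff there is an empty rectangle $(x_1,y_1,x_2,y_2)$ with $x_1\le i\le x_2$, $y_1\le j\le y_2$ such that (1) $x_1=0$ or $f(x_1-1,j')=1$ for all $y_1\le j'\le y_2$; (2) $x_2=n-1$ or $f(x_2+1,j')=1$ for all $y_1\le j'\le y_2$; (3) $y_1=0$ or $f(i',y_1-1)=1$ for all $x_1\le i'\le x_2$; (4) $y_2=n-1$ or $f(i',y_2+1)=1$ for all $x_1\le i'\le x_2$. Problem $LREC2(f,n,h,w)$ (Largest Empty Rectangle for Rectangle Empty Areas): under the promise that the empty areas of $f$ are rectangles, output an empty rectangle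 of height at least $h$ and width at least $w$ whose size is largest among all such empty rectangles (if there is none, output $(NULL,NULL,NULL,NULL)$). The integers $h,w$ are known to the algorithm. Query model: the input is the table of values of $f$, and a query reveals one value $f(i,j)$. In the quantum case a query is one application of the unitary $|i,j\rangle|z\rangle|w\rangle\mapsto|i,j\rangle|z+f(i,j) \bmod 2\rangle|w\rangle$, interleaved with arbitrary input-independent unitaries and followed by a final measurement. The (randomized or quantum) query complexity of the problem is the smallest worst-case number of queries of an algorithm that, on every instance satisfying the promise, outputs a correct answer with probability at least $2/3$. *)

theory Defs
  imports
    "HOL-Probability.Probability_Mass_Function"
    "HOL-Library.Extended_Nat"
    "HOL-Library.Extended_Real"
    "HOL-Library.Landau_Symbols"
begin

section \<open>Empty rectangles and the problem LREC2\<close>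

type_synonym grid_map = "nat \<times> nat \<Rightarrow> nat"

text \<open>Ordered as \<open>(x\<^sub>1, y\<^sub>1, x\<^sub>2, y\<^sub>2)\<close>; the \<open>x\<close>-coordinate is the first argument of the map.\<close>

type_synonym rect = "nat \<times> nat \<times> nat \<times> nat"

definition grid_maps :: "nat \<Rightarrow> grid_map set" where
  "grid_maps n = ({..<n} \<times> {..<n}) \<rightarrow>\<^sub>E {0, 1}"

fun width :: "rect \<Rightarrow> nat" where
  "width (x1, y1, x2, y2) = x2 - x1 + 1"

fun height :: "rect \<Rightarrow> nat" where
  "height (x1, y1, x2, y2) = y2 - y1 + 1"

definition area :: "rect \<Rightarrow> nat" where
  "area r = width r * height r"

fun empty_rect :: "nat \<Rightarrow> grid_map \<Rightarrow> rect \<Rightarrow> bool" where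
  "empty_rect n f (x1, y1, x2, y2) \<longleftrightarrow>
     x1 \<le> x2 \<and> x2 < n \<and> y1 \<le> y2 \<and> y2 < n \<and>
     (\<forall>i\<in>{x1..x2}. \<forall>j\<in>{y1..y2}. f (i, j) = 0)"

fun enclosed :: "nat \<Rightarrow> grid_map \<Rightarrow> rect \<Rightarrow> bool" where
  "enclosed n f (x1, y1, x2, y2) \<longleftrightarrow>
     (x1 = 0 \<or> (\<forall>j\<in>{y1..y2}. f (x1 - 1, j) = 1)) \<and>
     (x2 = n - 1 \<or> (\<forall>j\<in>{y1..y2}. f (x2 + 1, j) = 1)) \<and>
     (y1 = 0 \<or> (\<forall>i\<in>{x1..x2}. f (i, y1 - 1) = 1)) \<and>
     (y2 = n - 1 \<or> (\<forall>i\<in>{x1..x2}. f (i, y2 + 1) = 1))"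

definition empty_areas_are_rects :: "nat \<Rightarrow> grid_map \<Rightarrow> bool" where
  "empty_areas_are_rects n f \<longleftrightarrow>
     (\<forall>i<n. \<forall>j<n. f (i, j) = 0 \<longleftrightarrow>
        (\<exists>x1 y1 x2 y2. empty_rect n f (x1, y1, x2, y2) \<and> i \<in> {x1..x2} \<and> j \<in> {y1..y2} \<and>
           enclosed n f (x1, y1, x2, y2)))"

definition LREC2_promise :: "nat \<Rightarrow> grid_map set" where
  "LREC2_promise n = {f \<in> grid_maps n. empty_areas_are_rects n f}"

definition admissible :: "nat \<Rightarrow> nat \<Rightarrow> nat \<Rightarrow> grid_map \<Rightarrow> rect \<Rightarrow> bool" where
  "admissible n h w f r \<longleftrightarrow> empty_rect n f r \<and> h \<le> height r \<and> w \<le> width r"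

text \<open>The output \<open>None\<close> stands for the quadruple (NULL, NULL, NULL, NULL).\<close>

fun LREC2_correct :: "nat \<Rightarrow> nat \<Rightarrow> nat \<Rightarrow> grid_map \<Rightarrow> rect option \<Rightarrow> bool" where
  "LREC2_correct n h w f None \<longleftrightarrow> (\<nexists>r. admissible n h w f r)"
| "LREC2_correct n h w f (Some r) \<longleftrightarrow>
     admissible n h w f r \<and> (\<forall>r'. admissible n h w f r' \<longrightarrow> area r' \<le> area r)"

section \<open>Query complexity of promise problems on grid maps\<close>

text \<open>
  A promise problem is given by a set \<open>P\<close> of allowed inputs and a relation \<open>C\<close>, where
  \<open>C f a\<close> says that \<open>a\<close> is a correct answer on input \<open>f\<close>. Complexities are extended naturals
  so that the infimum over an empty set of algorithms would be \<open>\<infinity>\<close>.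
\<close>

subsection \<open>Deterministic and randomized algorithms\<close>

datatype 'a dtree = Answer 'a | Query "nat \<times> nat" "'a dtree" "'a dtree"

primrec valid_dtree :: "nat \<Rightarrow> 'a dtree \<Rightarrow> bool" where
  "valid_dtree n (Answer a) \<longleftrightarrow> True"
| "valid_dtree n (Query p t0 t1) \<longleftrightarrow>
     p \<in> {..<n} \<times> {..<n} \<and> valid_dtree n t0 \<and> valid_dtree n t1"

primrec run_dtree :: "grid_map \<Rightarrow> 'a dtree \<Rightarrow> 'a" where
  "run_dtree f (Answer a) = a"
| "run_dtree f (Query p t0 t1) = (if f p = 0 then run_dtree f t0 else run_dtree f t1)"

primrec num_queries :: "grid_map \<Rightarrow> 'a dtree \<Rightarrow> nat" where
  "num_queries f (Answer a) = 0"
| "num_queries f (Query p t0 t1) =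
     Suc (if f p = 0 then num_queries f t0 else num_queries f t1)"

definition det_query_complexity ::
    "nat \<Rightarrow> grid_map set \<Rightarrow> (grid_map \<Rightarrow> 'a \<Rightarrow> bool) \<Rightarrow> enat" where
  "det_query_complexity n P C =
     Inf {enat q | q. \<exists>t. valid_dtree n t \<and>
       (\<forall>f\<in>P. num_queries f t \<le> q \<and> C f (run_dtree f t))}"

text \<open>
  A randomized algorithm is a probability distribution on deterministic ones; its number of
  queries is the worst case over inputs and over random choices.
\<close>

definition rand_query_complexity ::
    "nat \<Rightarrow> grid_map set \<Rightarrow> (grid_map \<Rightarrow> 'a \<Rightarrow> bool) \<Rightarrow> enat" where
  "rand_query_complexity n P C =
     Inf {enat q | q. \<exists>A :: 'a dtree pmf. (\<forall>t\<in>set_pmf A. valid_dtree n t) \<and>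
       (\<forall>f\<in>P. (\<forall>t\<in>set_pmf A. num_queries f t \<le> q) \<and>
          measure_pmf.prob A {t. C f (run_dtree f t)} \<ge> 2 / 3)}"

subsection \<open>Quantum algorithms\<close>

text \<open>
  The computational basis consists of the labels \<open>(i, j, z, v)\<close> of the states
  \<open>|i,j\<rangle>|z\<rangle>|v\<rangle>\<close>, where the work register has \<open>m\<close> basis states.
  States and operators are given by their coordinates and matrix entries (row, then column) in
  this basis; values outside of the basis are irrelevant.
\<close>

type_synonym qlabel = "nat \<times> nat \<times> nat \<times> nat"
type_synonym qstate = "qlabel \<Rightarrow> complex"
type_synonym qop = "qlabel \<Rightarrow> qlabel \<Rightarrow> complex"

definition qbasis :: "nat \<Rightarrow> nat \<Rightarrow> qlabel set" where
  "qbasis n m = {..<n} \<times> {..<n} \<times> {..<2} \<times> {..<m}"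

definition unitary_on :: "qlabel set \<Rightarrow> qop \<Rightarrow> bool" where
  "unitary_on B U \<longleftrightarrow>
     (\<forall>a\<in>B. \<forall>b\<in>B. (\<Sum>c\<in>B. cnj (U c a) * U c b) = of_bool (a = b)) \<and>
     (\<forall>a\<in>B. \<forall>b\<in>B. (\<Sum>c\<in>B. U a c * cnj (U b c)) = of_bool (a = b))"

definition apply_op :: "qlabel set \<Rightarrow> qop \<Rightarrow> qstate \<Rightarrow> qstate" where
  "apply_op B U \<psi> = (\<lambda>a. \<Sum>b\<in>B. U a b * \<psi> b)"

fun query_label :: "grid_map \<Rightarrow> qlabel \<Rightarrow> qlabel" where
  "query_label f (i, j, z, v) = (i, j, (z + f (i, j)) mod 2, v)"

definition query_op :: "grid_map \<Rightarrow> qop" where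
  "query_op f = (\<lambda>a b. of_bool (a = query_label f b))"

definition initial_qstate :: qstate where
  "initial_qstate = (\<lambda>a. of_bool (a = (0, 0, 0, 0)))"

text \<open>State after \<open>U 0\<close>, followed by \<open>q\<close> rounds of one query and the next unitary.\<close>

primrec final_qstate ::
    "qlabel set \<Rightarrow> (nat \<Rightarrow> qop) \<Rightarrow> grid_map \<Rightarrow> nat \<Rightarrow> qstate" where
  "final_qstate B U f 0 = apply_op B (U 0) initial_qstate"
| "final_qstate B U f (Suc q) =
     apply_op B (U (Suc q)) (apply_op B (query_op f) (final_qstate B U f q))"

text \<open>
  The final measurement is in the computational basis; outcome \<open>a\<close> is reported as \<open>out a\<close>.
  Any other measurement is obtained through the last unitary and a larger work register.
\<close>

definition quantum_query_complexity ::
    "nat \<Rightarrow> grid_map set \<Rightarrow> (grid_map \<Rightarrow> 'a \<Rightarrow> bool) \<Rightarrow> enat" where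
  "quantum_query_complexity n P C =
     Inf {enat q | q. \<exists>m U (out :: qlabel \<Rightarrow> 'a). m \<ge> 1 \<and>
       (\<forall>k\<le>q. unitary_on (qbasis n m) (U k)) \<and>
       (\<forall>f\<in>P. (\<Sum>a | a \<in> qbasis n m \<and> C f (out a).
          (cmod (final_qstate (qbasis n m) U f q a))\<^sup>2) \<ge> 2 / 3)}"

section \<open>Complexity of LREC2 as a function of the side length\<close>

text \<open>
  The parameters \<open>h\<close> and \<open>w\<close> are known to the algorithm, so the algorithm may depend on them, and
  the worst case over \<open>h\<close> and \<open>w\<close> is the maximum of the individual complexities.
\<close>

definition LREC2_det :: "nat \<Rightarrow> enat" where
  "LREC2_det n = (SUP h\<in>{1..n}. SUP w\<in>{1..n}.
     det_query_complexity n (LREC2_promise n) (LREC2_correct n h w))"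

definition LREC2_rand :: "nat \<Rightarrow> enat" where
  "LREC2_rand n = (SUP h\<in>{1..n}. SUP w\<in>{1..n}.
     rand_query_complexity n (LREC2_promise n) (LREC2_correct n h w))"

definition LREC2_quantum :: "nat \<Rightarrow> enat" where
  "LREC2_quantum n = (SUP h\<in>{1..n}. SUP w\<in>{1..n}.
     quantum_query_complexity n (LREC2_promise n) (LREC2_correct n h w))"

text \<open>The library's \<open>\<Omega>\<close> requires values in a field, hence this version for extended naturals.\<close>

definition is_Omega :: "(nat \<Rightarrow> enat) \<Rightarrow> (nat \<Rightarrow> real) \<Rightarrow> bool" where
  "is_Omega F g \<longleftrightarrow>
     (\<exists>c>0. \<forall>\<^sub>F n in sequentially. ereal (c * g n) \<le> ereal_of_enat (F n))"

end

theory Submission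
  imports Defs
begin

text \<open>
  With \<open>h = w = 1\<close> the problem is as hard as deciding whether a table of \<open>n\<^sup>2\<close> ones has been
  corrupted by a single zero, i.e. unstructured search in \<open>N = n\<^sup>2\<close> cells. A randomized algorithm
  has to probe every cell of the all-ones map with probability at least \<open>1/3\<close>, which costs
  \<open>N/3\<close> queries. A quantum algorithm is bounded by the hybrid argument of Bennett, Bernstein,
  Brassard and Vazirani: placing a zero at cell \<open>p\<close> perturbs the final state by at most twice the
  sum over time of the amplitude with which \<open>p\<close> is queried on the all-ones map, and the squares of
  these amplitudes sum to \<open>1\<close> over \<open>p\<close> at each time, so some perturbation is of order \<open>q/\<surd>N\<close>.
\<close>

section \<open>The search family\<close>

text \<open>\<open>restrict\<close> makes the map \<open>undefined\<close> off the square, as the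
  extensional function space in \<open>grid_maps\<close> demands.\<close>

definition all_ones :: "nat \<Rightarrow> grid_map" where
  "all_ones n = restrict (\<lambda>_. 1) ({..<n} \<times> {..<n})"

definition single_zero :: "nat \<Rightarrow> nat \<times> nat \<Rightarrow> grid_map" where
  "single_zero n p = restrict (\<lambda>x. if x = p then 0 else 1) ({..<n} \<times> {..<n})"

lemma all_ones_apply [simp]: "i < n \<Longrightarrow> j < n \<Longrightarrow> all_ones n (i, j) = 1"
  by (simp add: all_ones_def)

lemma single_zero_apply [simp]:
  "i < n \<Longrightarrow> j < n \<Longrightarrow> single_zero n p (i, j) = (if (i, j) = p then 0 else 1)"
  by (simp add: single_zero_def)

lemma single_zero_eq_all_ones:
  "x \<in> {..<n} \<times> {..<n} \<Longrightarrow> x \<noteq> p \<Longrightarrow> single_zero n p x = all_ones n x"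
  by (auto simp: single_zero_def all_ones_def)

lemma not_empty_rect_all_ones: "\<not> empty_rect n (all_ones n) r"
  by (cases r) (fastforce simp: Ball_def)

text \<open>With no zero cell and no empty rectangle, both sides of the defining equivalence are
  false everywhere.\<close>

lemma all_ones_promise: "all_ones n \<in> LREC2_promise n"
  using not_empty_rect_all_ones[of n]
  by (auto simp: LREC2_promise_def grid_maps_def empty_areas_are_rects_def all_ones_def
           simp del: empty_rect.simps)

lemma empty_rect_single_zero:
  "i < n \<Longrightarrow> j < n \<Longrightarrow> empty_rect n (single_zero n (i, j)) (i, j, i, j)"
  by simp

text \<open>The zero cell forms a 1-by-1 empty rectangle, and each of its neighbours in the grid
  carries a one.\<close>

lemma single_zero_promise:
  assumes "i < n" "j < n"
  shows "single_zero n (i, j) \<in> LREC2_promise n"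
proof -
  \<comment> \<open>The map has a known value at the next index only inside the grid; the
    alternative is the boundary case of \<open>enclosed\<close>.\<close>
  have bound: "k = n - 1 \<or> Suc k < n" if "k < n" for k using that by auto
  have enclosed: "enclosed n (single_zero n (i, j)) (i, j, i, j)"
    using assms bound[of i] bound[of j] by auto
  have "empty_areas_are_rects n (single_zero n (i, j))"
    unfolding empty_areas_are_rects_def
  proof (intro allI impI iffI)
    fix k l assume kl: "k < n" "l < n" "single_zero n (i, j) (k, l) = 0"
    then have "k = i" "l = j" by (auto split: if_splits)
    then show "\<exists>x1 y1 x2 y2. empty_rect n (single_zero n (i, j)) (x1, y1, x2, y2) \<and>
        k \<in> {x1..x2} \<and> l \<in> {y1..y2} \<and> enclosed n (single_zero n (i, j)) (x1, y1, x2, y2)"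
      using enclosed empty_rect_single_zero[OF assms]
      by (metis atLeastAtMost_iff order.refl)
  qed (metis empty_rect.simps)
  moreover have "single_zero n (i, j) \<in> grid_maps n"
    by (auto simp: grid_maps_def single_zero_def)
  ultimately show ?thesis by (simp add: LREC2_promise_def)
qed

text \<open>On all ones only \<open>None\<close> is correct, whereas a zero at \<open>p\<close>
  makes a 1-by-1 rectangle admissible and \<open>None\<close> wrong. Answering correctly thus
  amounts to detecting the zero.\<close>

lemma LREC2_correct_all_ones_single_zero:
  assumes "p \<in> {..<n} \<times> {..<n}" "LREC2_correct n 1 1 (all_ones n) a"
  shows "\<not> LREC2_correct n 1 1 (single_zero n p) a"
proof (cases a)
  case None
  obtain i j where "p = (i, j)" by force
  then have "admissible n 1 1 (single_zero n p) (i, j, i, j)"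
    using assms(1) by (simp add: admissible_def)
  then show ?thesis using None by auto
next
  case (Some r)
  then show ?thesis using assms(2) not_empty_rect_all_ones by (auto simp: admissible_def)
qed

section \<open>Classical search\<close>

text \<open>A set rather than a list, so that a cell read repeatedly counts once and cardinality
  bounds the queries from below.\<close>

primrec probed :: "grid_map \<Rightarrow> 'a dtree \<Rightarrow> (nat \<times> nat) set" where
  "probed f (Answer a) = {}"
| "probed f (Query p t0 t1) = insert p (if f p = 0 then probed f t0 else probed f t1)"

lemma finite_probed [simp]: "finite (probed f t)"
  by (induction t) auto

lemma card_probed_le: "card (probed f t) \<le> num_queries f t"
proof (induction t)
  case (Query p t0 t1)
  then show ?case
    by (auto simp: card_insert_if)
qed simp

text \<open>Agreement on the cells read in the run on \<open>f\<close> sends \<open>g\<close> down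
  the same branch of the tree.\<close>

lemma run_dtree_cong: "(\<And>x. x \<in> probed f t \<Longrightarrow> g x = f x) \<Longrightarrow> run_dtree g t = run_dtree f t"
  by (induction t) auto

lemma probed_subset: "valid_dtree n t \<Longrightarrow> probed f t \<subseteq> {..<n} \<times> {..<n}"
  by (induction t) auto

lemma rand_search_bound:
  fixes A :: "'a dtree pmf"
  assumes valid: "\<And>t. t \<in> set_pmf A \<Longrightarrow> valid_dtree n t"
    and queries: "\<And>t. t \<in> set_pmf A \<Longrightarrow> num_queries (all_ones n) t \<le> q"
    and ones: "measure_pmf.prob A {t. C (all_ones n) (run_dtree (all_ones n) t)} \<ge> 2 / 3"
    and zero: "\<And>p. p \<in> {..<n} \<times> {..<n} \<Longrightarrow>
      measure_pmf.prob A {t. C (single_zero n p) (run_dtree (single_zero n p) t)} \<ge> 2 / 3"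
    and disj: "\<And>p a. p \<in> {..<n} \<times> {..<n} \<Longrightarrow> C (all_ones n) a \<Longrightarrow> \<not> C (single_zero n p) a"
  shows "(real n)\<^sup>2 / 3 \<le> real q"
proof -
  let ?G = "{..<n} \<times> {..<n}"
  let ?V = "\<lambda>p. {t. p \<in> probed (all_ones n) t}"
  \<comment> \<open>Success on both inputs forces a probe of \<open>p\<close>: otherwise the two
    runs return the same answer, correct for both. By inclusion-exclusion joint success has
    probability at least 2/3 + 2/3 - 1.\<close>
  have hit: "1 / 3 \<le> measure_pmf.prob A (?V p)" if p: "p \<in> ?G" for p
  proof -
    let ?S = "{t. C (all_ones n) (run_dtree (all_ones n) t)}"
    let ?T = "{t. C (single_zero n p) (run_dtree (single_zero n p) t)}"
    have "AE t in measure_pmf A. t \<in> ?S \<inter> ?T \<longrightarrow> t \<in> ?V p"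
    proof (rule AE_pmfI, rule impI)
      fix t assume t: "t \<in> set_pmf A" "t \<in> ?S \<inter> ?T"
      show "t \<in> ?V p"
      proof (rule ccontr)
        assume "t \<notin> ?V p"
        then have "run_dtree (single_zero n p) t = run_dtree (all_ones n) t"
          using probed_subset[OF valid[OF t(1)], of "all_ones n"]
          by (intro run_dtree_cong single_zero_eq_all_ones) auto
        with t(2) disj[OF p] show False by auto
      qed
    qed
    then have "measure_pmf.prob A (?S \<inter> ?T) \<le> measure_pmf.prob A (?V p)"
      by (intro measure_pmf.finite_measure_mono_AE) auto
    moreover have "measure_pmf.prob A ?S + measure_pmf.prob A ?T =
        measure_pmf.prob A (?S \<union> ?T) + measure_pmf.prob A (?S \<inter> ?T)"
      by (subst measure_pmf.finite_measure_Union')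
         (auto simp: measure_pmf.finite_measure_Diff' Int_commute)
    moreover have "measure_pmf.prob A (?S \<union> ?T) \<le> 1" by simp
    ultimately show ?thesis using ones zero[OF p] by linarith
  qed
  have int: "integrable (measure_pmf A) (indicat_real (?V p))" for p
    by (rule measure_pmf.integrable_const_bound[where B = 1]) auto
  \<comment> \<open>Linearity of expectation: the probe probabilities sum to the expected number of
    distinct probed cells, which is at most \<open>q\<close>.\<close>
  have "(real n)\<^sup>2 / 3 = (\<Sum>p\<in>?G. 1 / 3)"
    by (simp add: power2_eq_square)
  also have "\<dots> \<le> (\<Sum>p\<in>?G. measure_pmf.prob A (?V p))"
    by (intro sum_mono hit)
  also have "\<dots> = (\<Sum>p\<in>?G. measure_pmf.expectation A (indicat_real (?V p)))"
    by simp
  also have "\<dots> = measure_pmf.expectation A (\<lambda>t. \<Sum>p\<in>?G. indicat_real (?V p) t)"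
    by (rule Bochner_Integration.integral_sum[symmetric]) (rule int)
  also have "\<dots> \<le> measure_pmf.expectation A (\<lambda>_. real q)"
  proof (rule integral_mono_AE)
    show "integrable (measure_pmf A) (\<lambda>t. \<Sum>p\<in>?G. indicat_real (?V p) t)"
      by (rule Bochner_Integration.integrable_sum) (rule int)
    show "AE t in measure_pmf A. (\<Sum>p\<in>?G. indicat_real (?V p) t) \<le> real q"
    proof (rule AE_pmfI)
      fix t assume t: "t \<in> set_pmf A"
      have "(\<Sum>p\<in>?G. indicat_real (?V p) t) = real (card (?G \<inter> probed (all_ones n) t))"
        by (simp add: indicator_def sum.If_cases Int_def)
      also have "\<dots> \<le> real (card (probed (all_ones n) t))"
        by (simp add: card_mono)
      also have "\<dots> \<le> real q"
        using card_probed_le[of "all_ones n" t] queries[OF t] by linarith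
      finally show "(\<Sum>p\<in>?G. indicat_real (?V p) t) \<le> real q" .
    qed
  qed simp
  finally show ?thesis by simp
qed

section \<open>Quantum search\<close>

definition state_norm :: "qlabel set \<Rightarrow> qstate \<Rightarrow> real" where
  "state_norm B \<psi> = L2_set (\<lambda>a. cmod (\<psi> a)) B"

lemma state_norm_power2: "(state_norm B \<psi>)\<^sup>2 = (\<Sum>a\<in>B. (cmod (\<psi> a))\<^sup>2)"
  by (simp add: state_norm_def L2_set_def sum_nonneg)

lemma state_norm_nonneg [simp]: "0 \<le> state_norm B \<psi>"
  by (simp add: state_norm_def)

lemma state_norm_cong: "(\<And>a. a \<in> B \<Longrightarrow> \<psi> a = \<phi> a) \<Longrightarrow> state_norm B \<psi> = state_norm B \<phi>"
  unfolding state_norm_def by (rule L2_set_cong) auto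

lemma state_norm_triangle: "state_norm B (\<lambda>a. \<psi> a + \<phi> a) \<le> state_norm B \<psi> + state_norm B \<phi>"
  unfolding state_norm_def
  by (rule order.trans[OF L2_set_mono L2_set_triangle_ineq]) (auto intro: norm_triangle_ineq)

lemma state_norm_minus_le: "state_norm B (\<lambda>a. \<psi> a - \<phi> a) \<le> state_norm B \<psi> + state_norm B \<phi>"
  using state_norm_triangle[of B \<psi> "\<lambda>a. - \<phi> a"] by (simp add: state_norm_def)

lemma state_norm_reindex:
  "bij_betw g B B \<Longrightarrow> state_norm B (\<lambda>a. \<psi> (g a)) = state_norm B \<psi>"
  unfolding state_norm_def L2_set_def
  by (subst sum.reindex_bij_betw[symmetric, of g B B]) auto

lemma state_norm_supported:
  assumes "finite B" "A \<subseteq> B" "\<And>a. a \<in> B - A \<Longrightarrow> \<psi> a = 0"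
  shows "state_norm B \<psi> = state_norm A \<psi>"
  unfolding state_norm_def L2_set_def
  by (rule arg_cong[of _ _ sqrt]) (use assms in \<open>auto intro!: sum.mono_neutral_right\<close>)

lemma state_norm_mono: "finite B \<Longrightarrow> A \<subseteq> B \<Longrightarrow> state_norm A \<psi> \<le> state_norm B \<psi>"
  unfolding state_norm_def L2_set_def by (auto intro: sum_mono2)

section \<open>Linearity and norm preservation of unitary steps\<close>

lemma apply_op_diff:
  "apply_op B U \<psi> a - apply_op B U \<phi> a = apply_op B U (\<lambda>b. \<psi> b - \<phi> b) a"
  by (simp add: apply_op_def algebra_simps sum_subtractf)

lemma state_norm_unitary:
  assumes "finite B" "unitary_on B U"
  shows "state_norm B (apply_op B U \<psi>) = state_norm B \<psi>"
proof -
  have "complex_of_real (\<Sum>a\<in>B. (cmod (apply_op B U \<psi> a))\<^sup>2) =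
      (\<Sum>a\<in>B. (\<Sum>b\<in>B. U a b * \<psi> b) * (\<Sum>c\<in>B. cnj (U a c) * cnj (\<psi> c)))"
    by (simp add: complex_norm_square apply_op_def del: of_real_power)
  also have "\<dots> = (\<Sum>a\<in>B. \<Sum>b\<in>B. \<Sum>c\<in>B. \<psi> b * cnj (\<psi> c) * (cnj (U a c) * U a b))"
    by (simp add: sum_product mult_ac)
  also have "\<dots> = (\<Sum>b\<in>B. \<Sum>a\<in>B. \<Sum>c\<in>B. \<psi> b * cnj (\<psi> c) * (cnj (U a c) * U a b))"
    by (rule sum.swap)
  \<comment> \<open>With the sum over the row index \<open>a\<close> innermost, orthonormality of
    the columns of \<open>U\<close> leaves only the diagonal terms.\<close>
  also have "\<dots> = (\<Sum>b\<in>B. \<Sum>c\<in>B. \<psi> b * cnj (\<psi> c) * (\<Sum>a\<in>B. cnj (U a c) * U a b))"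
    unfolding sum_distrib_left by (intro sum.cong refl sum.swap)
  also have "\<dots> = (\<Sum>b\<in>B. \<Sum>c\<in>B. \<psi> b * cnj (\<psi> c) * of_bool (c = b))"
    using assms(2) by (intro sum.cong refl) (simp add: unitary_on_def)
  also have "\<dots> = (\<Sum>b\<in>B. \<psi> b * cnj (\<psi> b))"
    using assms(1) by (simp add: of_bool_def if_distrib sum.delta cong: if_cong)
  also have "\<dots> = complex_of_real (\<Sum>a\<in>B. (cmod (\<psi> a))\<^sup>2)"
    by (simp add: complex_norm_square del: of_real_power)
  finally have "(\<Sum>a\<in>B. (cmod (apply_op B U \<psi> a))\<^sup>2) = (\<Sum>a\<in>B. (cmod (\<psi> a))\<^sup>2)"
    using of_real_eq_iff by blast
  then show ?thesis by (simp add: state_norm_def L2_set_def)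
qed

section \<open>Queries as permutations of the basis\<close>

lemma finite_qbasis [simp]: "finite (qbasis n m)"
  by (simp add: qbasis_def)

text \<open>Labels whose query register holds \<open>p\<close>: the norm of a state on this set is
  the amplitude with which \<open>p\<close> is about to be queried.\<close>

definition cell_basis :: "nat \<Rightarrow> nat \<Rightarrow> nat \<times> nat \<Rightarrow> qlabel set" where
  "cell_basis n m p = {(i, j, z, v) \<in> qbasis n m. (i, j) = p}"

lemma cell_basis_subset: "cell_basis n m p \<subseteq> qbasis n m"
  by (auto simp: cell_basis_def)

lemma finite_cell_basis [simp]: "finite (cell_basis n m p)"
  by (rule finite_subset[OF cell_basis_subset]) simp

text \<open>Two queries add \<open>f (i, j)\<close> twice, an even number, and \<open>z < 2\<close>
  makes \<open>z mod 2\<close> equal to \<open>z\<close>.\<close>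

lemma query_label_involution:
  assumes "a \<in> qbasis n m"
  shows "query_label f (query_label f a) = a"
proof -
  obtain i j z v where a: "a = (i, j, z, v)" by (metis prod.collapse)
  with assms have "z < 2" by (simp add: qbasis_def)
  moreover have "((z + f (i, j)) mod 2 + f (i, j)) mod 2 = z mod 2"
    by (metis (no_types) add.assoc mod_add_left_eq mult_2 mod_mult_self2)
  ultimately show ?thesis by (simp add: a)
qed

lemma query_label_qbasis: "a \<in> qbasis n m \<Longrightarrow> query_label f a \<in> qbasis n m"
  by (cases a) (auto simp: qbasis_def)

lemma query_label_cell_basis: "a \<in> cell_basis n m p \<Longrightarrow> query_label f a \<in> cell_basis n m p"
  by (cases a) (auto simp: cell_basis_def qbasis_def)

lemma bij_query_label_qbasis: "bij_betw (query_label f) (qbasis n m) (qbasis n m)"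
  by (rule bij_betwI[where g = "query_label f"])
     (auto intro: query_label_qbasis query_label_involution)

lemma bij_query_label_cell_basis:
  "bij_betw (query_label f) (cell_basis n m p) (cell_basis n m p)"
  by (rule bij_betwI[where g = "query_label f"])
     (auto intro!: query_label_cell_basis query_label_involution[of _ n m]
           dest: subsetD[OF cell_basis_subset])

text \<open>A permutation matrix moves amplitudes along the inverse permutation, which here is
  \<open>query_label f\<close> itself.\<close>

lemma apply_query_op:
  assumes "a \<in> qbasis n m"
  shows "apply_op (qbasis n m) (query_op f) \<psi> a = \<psi> (query_label f a)"
proof -
  have "apply_op (qbasis n m) (query_op f) \<psi> a =
      (\<Sum>b\<in>qbasis n m. if b = query_label f a then \<psi> b else 0)"
    unfolding apply_op_def query_op_def
    by (intro sum.cong) (use assms query_label_involution in \<open>auto simp del: query_label.simps\<close>)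
  then show ?thesis using query_label_qbasis[OF assms] by simp
qed

lemma state_norm_query:
  "state_norm (qbasis n m) (apply_op (qbasis n m) (query_op f) \<psi>) = state_norm (qbasis n m) \<psi>"
proof -
  have "state_norm (qbasis n m) (apply_op (qbasis n m) (query_op f) \<psi>) =
      state_norm (qbasis n m) (\<lambda>a. \<psi> (query_label f a))"
    by (rule state_norm_cong) (rule apply_query_op)
  then show ?thesis by (simp add: state_norm_reindex[OF bij_query_label_qbasis])
qed

lemma query_label_single_zero:
  assumes "a \<in> qbasis n m - cell_basis n m p"
  shows "query_label (single_zero n p) a = query_label (all_ones n) a"
proof -
  obtain i j z v where "a = (i, j, z, v)" by (metis prod.collapse)
  with assms show ?thesis by (auto simp: cell_basis_def qbasis_def)
qed

text \<open>The two queries act alike off cell \<open>p\<close>. On its labels each merely permutes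
  the amplitudes of \<open>\<psi>\<close>, and the triangle inequality gives the factor 2.\<close>

lemma state_norm_query_diff:
  "state_norm (qbasis n m) (\<lambda>a. apply_op (qbasis n m) (query_op (single_zero n p)) \<psi> a -
     apply_op (qbasis n m) (query_op (all_ones n)) \<psi> a) \<le> 2 * state_norm (cell_basis n m p) \<psi>"
    (is "state_norm ?B ?d \<le> _")
proof -
  have "state_norm ?B ?d =
      state_norm ?B (\<lambda>a. \<psi> (query_label (single_zero n p) a) - \<psi> (query_label (all_ones n) a))"
    by (rule state_norm_cong) (simp add: apply_query_op)
  also have "\<dots> = state_norm (cell_basis n m p)
      (\<lambda>a. \<psi> (query_label (single_zero n p) a) - \<psi> (query_label (all_ones n) a))"
    by (rule state_norm_supported[OF _ cell_basis_subset])
       (simp_all only: finite_qbasis query_label_single_zero diff_self)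
  also have "\<dots> \<le> state_norm (cell_basis n m p) \<psi> + state_norm (cell_basis n m p) \<psi>"
    using state_norm_minus_le[of "cell_basis n m p" "\<lambda>a. \<psi> (query_label (single_zero n p) a)"
        "\<lambda>a. \<psi> (query_label (all_ones n) a)"]
    by (simp add: state_norm_reindex[OF bij_query_label_cell_basis])
  finally show ?thesis by simp
qed

section \<open>The hybrid argument\<close>

lemma state_norm_final:
  assumes "\<And>k. k \<le> q \<Longrightarrow> unitary_on (qbasis n m) (U k)" "0 < n" "0 < m"
  shows "state_norm (qbasis n m) (final_qstate (qbasis n m) U f q) = 1"
  using assms(1)
proof (induction q)
  case 0
  have "(\<Sum>a\<in>qbasis n m. (cmod (initial_qstate a))\<^sup>2) =
      (\<Sum>a\<in>qbasis n m. if a = (0, 0, 0, 0) then 1 else 0)"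
    by (intro sum.cong) (auto simp: initial_qstate_def)
  also have "\<dots> = 1"
    \<comment> \<open>Positivity of \<open>n\<close> and \<open>m\<close> puts the initial label
      \<open>(0, 0, 0, 0)\<close> into the basis.\<close>
    using assms(2,3) by (simp add: qbasis_def)
  finally have "state_norm (qbasis n m) initial_qstate = 1"
    by (simp add: state_norm_def L2_set_def)
  with 0 show ?case by (simp add: state_norm_unitary)
next
  case (Suc q)
  then show ?case by (simp add: state_norm_unitary state_norm_query)
qed

text \<open>Each query adds an error controlled by the amplitude at \<open>p\<close>, and later
  steps preserve the norm of that error. The right-hand side involves only the all-ones run, so its
  states are the same for all \<open>p\<close> and can be summed over cells.\<close>

lemma hybrid_bound:
  assumes "\<And>k. k \<le> q \<Longrightarrow> unitary_on (qbasis n m) (U k)"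
  shows "state_norm (qbasis n m) (\<lambda>a. final_qstate (qbasis n m) U (single_zero n p) q a -
      final_qstate (qbasis n m) U (all_ones n) q a) \<le>
    (\<Sum>t<q. 2 * state_norm (cell_basis n m p) (final_qstate (qbasis n m) U (all_ones n) t))"
  using assms
proof (induction q)
  case 0
  show ?case by (simp add: state_norm_def L2_set_def)
next
  case (Suc q)
  let ?B = "qbasis n m"
  let ?O = "\<lambda>f. apply_op ?B (query_op f)"
  let ?\<psi> = "final_qstate ?B U (single_zero n p) q" and ?\<phi> = "final_qstate ?B U (all_ones n) q"
  \<comment> \<open>Both runs apply the same unitary after the query, so it drops out of the norm of
    their difference.\<close>
  have "state_norm ?B (\<lambda>a. final_qstate ?B U (single_zero n p) (Suc q) a -
      final_qstate ?B U (all_ones n) (Suc q) a) =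
      state_norm ?B (\<lambda>a. ?O (single_zero n p) ?\<psi> a - ?O (all_ones n) ?\<phi> a)"
    using state_norm_unitary[OF finite_qbasis Suc.prems[OF order.refl],
        of "\<lambda>a. ?O (single_zero n p) ?\<psi> a - ?O (all_ones n) ?\<phi> a"]
    by (simp add: apply_op_diff)
  \<comment> \<open>The hybrid term queries the corrupted map in the all-ones state: the first
    summand transports the old error, the second is the error of this query.\<close>
  also have "\<dots> = state_norm ?B (\<lambda>a. ?O (single_zero n p) (\<lambda>b. ?\<psi> b - ?\<phi> b) a +
      (?O (single_zero n p) ?\<phi> a - ?O (all_ones n) ?\<phi> a))"
    by (simp add: apply_op_diff[symmetric])
  also have "\<dots> \<le> state_norm ?B (\<lambda>b. ?\<psi> b - ?\<phi> b) + 2 * state_norm (cell_basis n m p) ?\<phi>"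
    by (rule order.trans[OF state_norm_triangle])
       (simp add: state_norm_query state_norm_query_diff)
  also have "\<dots> \<le> (\<Sum>t<Suc q. 2 * state_norm (cell_basis n m p) (final_qstate ?B U (all_ones n) t))"
    using Suc by simp
  finally show ?case .
qed

text \<open>Pythagoras: the label sets of the cells partition the basis.\<close>

lemma sum_cell_basis:
  "(\<Sum>p\<in>{..<n} \<times> {..<n}. (state_norm (cell_basis n m p) \<psi>)\<^sup>2) = (state_norm (qbasis n m) \<psi>)\<^sup>2"
proof -
  have "(\<Sum>p\<in>{..<n} \<times> {..<n}. \<Sum>a\<in>cell_basis n m p. (cmod (\<psi> a))\<^sup>2) =
      (\<Sum>a\<in>(\<Union>p\<in>{..<n} \<times> {..<n}. cell_basis n m p). (cmod (\<psi> a))\<^sup>2)"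
    by (rule sum.UNION_disjoint[symmetric]) (auto, auto simp: cell_basis_def)
  also have "(\<Union>p\<in>{..<n} \<times> {..<n}. cell_basis n m p) = qbasis n m"
    by (auto simp: cell_basis_def qbasis_def)
  finally show ?thesis by (simp add: state_norm_power2)
qed

text \<open>\<open>\<psi>\<close> has mass at least 2/3 on \<open>S\<close>; \<open>\<phi>\<close>,
  having 2/3 on the disjoint \<open>T\<close>, has at most 1/3 there. Hence the states already
  differ on \<open>S\<close>.\<close>

lemma state_norm_diff_lower:
  assumes "finite B" "state_norm B \<phi> = 1" "S \<subseteq> B" "T \<subseteq> B" "S \<inter> T = {}"
    and "2 / 3 \<le> (\<Sum>a\<in>S. (cmod (\<psi> a))\<^sup>2)" "2 / 3 \<le> (\<Sum>a\<in>T. (cmod (\<phi> a))\<^sup>2)"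
  shows "1 / 5 \<le> state_norm B (\<lambda>a. \<phi> a - \<psi> a)"
proof -
  have fin: "finite S" "finite T" using assms finite_subset by auto
  have "(\<Sum>a\<in>S. (cmod (\<phi> a))\<^sup>2) + (\<Sum>a\<in>T. (cmod (\<phi> a))\<^sup>2) = (\<Sum>a\<in>S \<union> T. (cmod (\<phi> a))\<^sup>2)"
    by (rule sum.union_disjoint[symmetric]) (use fin assms in auto)
  also have "\<dots> \<le> (\<Sum>a\<in>B. (cmod (\<phi> a))\<^sup>2)"
    by (rule sum_mono2) (use assms in auto)
  also have "\<dots> = 1" using assms(2) by (simp flip: state_norm_power2)
  finally have "(state_norm S \<phi>)\<^sup>2 \<le> 1 / 3" using assms(7) by (simp add: state_norm_power2)
  \<comment> \<open>The fractions 3/5 and 4/5 bound the square roots of 1/3 from above and of 2/3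
    from below; their difference is the constant 1/5.\<close>
  then have "(state_norm S \<phi>)\<^sup>2 \<le> (3 / 5)\<^sup>2" by (simp add: power2_eq_square)
  then have 1: "state_norm S \<phi> \<le> 3 / 5" by (rule power2_le_imp_le) simp
  have "(4 / 5)\<^sup>2 \<le> (2 / 3 :: real)" by (simp add: power2_eq_square)
  with assms(6) have "(4 / 5)\<^sup>2 \<le> (state_norm S \<psi>)\<^sup>2"
    by (simp add: state_norm_power2)
  then have 2: "4 / 5 \<le> state_norm S \<psi>" by (rule power2_le_imp_le) simp
  have "state_norm S \<psi> \<le> state_norm S \<phi> + state_norm S (\<lambda>a. \<phi> a - \<psi> a)"
    using state_norm_minus_le[of S \<phi> "\<lambda>a. \<phi> a - \<psi> a"] by simp
  also have "state_norm S (\<lambda>a. \<phi> a - \<psi> a) \<le> state_norm B (\<lambda>a. \<phi> a - \<psi> a)"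
    by (rule state_norm_mono) (use assms in auto)
  finally show ?thesis using 1 2 by linarith
qed

lemma quantum_search_bound:
  assumes "0 < n" "0 < m"
    and unitary: "\<And>k. k \<le> q \<Longrightarrow> unitary_on (qbasis n m) (U k)"
    and ones: "2 / 3 \<le> (\<Sum>a | a \<in> qbasis n m \<and> C (all_ones n) (out a).
      (cmod (final_qstate (qbasis n m) U (all_ones n) q a))\<^sup>2)"
    and zero: "\<And>p. p \<in> {..<n} \<times> {..<n} \<Longrightarrow>
      2 / 3 \<le> (\<Sum>a | a \<in> qbasis n m \<and> C (single_zero n p) (out a).
        (cmod (final_qstate (qbasis n m) U (single_zero n p) q a))\<^sup>2)"
    and disj: "\<And>p a. p \<in> {..<n} \<times> {..<n} \<Longrightarrow> C (all_ones n) a \<Longrightarrow> \<not> C (single_zero n p) a"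
  shows "real n / 10 \<le> real q"
proof -
  let ?G = "{..<n} \<times> {..<n}"
  let ?\<phi> = "final_qstate (qbasis n m) U (all_ones n)"
  let ?w = "\<lambda>p t. state_norm (cell_basis n m p) (?\<phi> t)"
  \<comment> \<open>The lower bound 1/5 meets the hybrid bound; after squaring, Cauchy-Schwarz over
    the \<open>q\<close> query times turns amplitudes into their squares.\<close>
  have step: "1 / 25 \<le> 4 * (real q * (\<Sum>t<q. (?w p t)\<^sup>2))" if p: "p \<in> ?G" for p
  proof -
    have "1 / 5 \<le> state_norm (qbasis n m)
        (\<lambda>a. final_qstate (qbasis n m) U (single_zero n p) q a - ?\<phi> q a)"
      by (rule state_norm_diff_lower[OF _ _ _ _ _ ones zero[OF p]])
         (use disj[OF p] state_norm_final[OF unitary assms(1,2)] in auto)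
    also have "\<dots> \<le> 2 * (\<Sum>t<q. ?w p t)"
      using hybrid_bound[OF unitary, where p = p] by (simp add: sum_distrib_left)
    finally have "(1 / 5)\<^sup>2 \<le> (2 * (\<Sum>t<q. ?w p t))\<^sup>2"
      by (intro power_mono) auto
    also have "\<dots> = 4 * (\<Sum>t<q. ?w p t)\<^sup>2" by (simp add: power_mult_distrib)
    also have "\<dots> \<le> 4 * (real q * (\<Sum>t<q. (?w p t)\<^sup>2))"
      using sum_squared_le_sum_of_squares[of "?w p" "{..<q}"] by (simp add: mult.commute)
    finally show ?thesis by (simp add: power2_eq_square)
  qed
  have "(real n)\<^sup>2 / 25 = (\<Sum>p\<in>?G. 1 / 25)" by (simp add: power2_eq_square)
  also have "\<dots> \<le> (\<Sum>p\<in>?G. 4 * (real q * (\<Sum>t<q. (?w p t)\<^sup>2)))"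
    by (intro sum_mono step)
  \<comment> \<open>With the cells summed first, the squared amplitudes at each time add up to the
    squared norm 1 of the all-ones state.\<close>
  also have "\<dots> = 4 * (real q * (\<Sum>t<q. \<Sum>p\<in>?G. (?w p t)\<^sup>2))"
    by (simp add: sum_distrib_left[symmetric] sum.swap[of _ "{..<q}"])
  also have "\<dots> = 4 * (real q * (\<Sum>t<q. 1))"
    by (simp add: sum_cell_basis state_norm_final[OF unitary assms(1,2)])
  also have "\<dots> = (2 * real q)\<^sup>2" by (simp add: power2_eq_square)
  finally have "(real n / 5)\<^sup>2 \<le> (2 * real q)\<^sup>2" by (simp add: power2_eq_square)
  then have "real n / 5 \<le> 2 * real q" by (rule power2_le_imp_le) simp
  then show ?thesis by simp
qed

section \<open>Lower bounds for LREC2\<close>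

text \<open>A nonempty set of extended naturals attains its infimum, so the bound for single
  algorithms carries over; the empty set gives \<open>\<infinity>\<close>.\<close>

lemma ereal_le_Inf_enat:
  assumes "\<And>q. P q \<Longrightarrow> b \<le> real q"
  shows "ereal b \<le> ereal_of_enat (Inf {enat q | q. P q})"
proof (cases "\<exists>q. P q")
  case True
  then obtain k where "P k" by blast
  then have "enat k \<in> {enat q | q. P q}" by blast
  then have "Inf {enat q | q. P q} \<in> {enat q | q. P q}" by (rule wellorder_InfI)
  then obtain q where "Inf {enat q | q. P q} = enat q" "P q" by auto
  with assms show ?thesis by simp
next
  case False
  then have "Inf {enat q | q. P q} = \<infinity>" by (simp add: Inf_enat_def)
  then show ?thesis by simp
qed

text \<open>A decision tree is a randomized algorithm via its point mass, so the randomized infimum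
  ranges over at least as many query counts.\<close>

lemma rand_le_det_query_complexity:
  "rand_query_complexity n P C \<le> det_query_complexity n P C"
  unfolding rand_query_complexity_def det_query_complexity_def
proof (rule Inf_superset_mono, clarify)
  fix q and t :: "'a dtree"
  assume t: "valid_dtree n t" "\<forall>f\<in>P. num_queries f t \<le> q \<and> C f (run_dtree f t)"
  show "\<exists>qa. enat q = enat qa \<and> (\<exists>A::'a dtree pmf. (\<forall>t\<in>set_pmf A. valid_dtree n t) \<and>
       (\<forall>f\<in>P. (\<forall>t\<in>set_pmf A. num_queries f t \<le> qa) \<and>
          measure_pmf.prob A {t. C f (run_dtree f t)} \<ge> 2 / 3))"
    by (intro exI[of _ q] conjI refl exI[of _ "return_pmf t"]) (use t in auto)
qed

lemma LREC2_rand_lower: "ereal ((real n)\<^sup>2 / 3) \<le>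
  ereal_of_enat (rand_query_complexity n (LREC2_promise n) (LREC2_correct n 1 1))"
  unfolding rand_query_complexity_def
proof (rule ereal_le_Inf_enat, elim exE conjE)
  fix q and A :: "rect option dtree pmf"
  assume "\<forall>t\<in>set_pmf A. valid_dtree n t"
    "\<forall>f\<in>LREC2_promise n. (\<forall>t\<in>set_pmf A. num_queries f t \<le> q) \<and>
       2 / 3 \<le> measure_pmf.prob A {t. LREC2_correct n 1 1 f (run_dtree f t)}"
  then show "(real n)\<^sup>2 / 3 \<le> real q"
    using all_ones_promise single_zero_promise LREC2_correct_all_ones_single_zero
    by (intro rand_search_bound[where C = "LREC2_correct n 1 1" and A = A]) blast+
qed

lemma LREC2_quantum_lower:
  assumes "0 < n"
  shows "ereal (real n / 10) \<le>
    ereal_of_enat (quantum_query_complexity n (LREC2_promise n) (LREC2_correct n 1 1))"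
  unfolding quantum_query_complexity_def
proof (rule ereal_le_Inf_enat, elim exE conjE)
  fix q m U and out :: "qlabel \<Rightarrow> rect option"
  assume *: "1 \<le> m" "\<forall>k\<le>q. unitary_on (qbasis n m) (U k)"
    "\<forall>f\<in>LREC2_promise n. 2 / 3 \<le> (\<Sum>a | a \<in> qbasis n m \<and> LREC2_correct n 1 1 f (out a).
       (cmod (final_qstate (qbasis n m) U f q a))\<^sup>2)"
  show "real n / 10 \<le> real q"
  proof (rule quantum_search_bound[where C = "LREC2_correct n 1 1" and out = out and
          m = m and U = U])
    show "0 < m" using *(1) by simp
    show "unitary_on (qbasis n m) (U k)" if "k \<le> q" for k using *(2) that by blast
  qed (use assms LREC2_correct_all_ones_single_zero all_ones_promise single_zero_promise *(3)
       in \<open>auto simp del: query_label.simps LREC2_correct.simps\<close>)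
qed

text \<open>Reduces the three bounds to \<open>h = w = 1\<close>: the suprema dominate this term,
  and a factor \<open>T n\<close> of at least 1 does not decrease them.\<close>

lemma is_OmegaI:
  fixes T :: "nat \<Rightarrow> nat"
  assumes "\<And>n. 1 \<le> T n" "0 < c"
    and "\<And>n. 0 < n \<Longrightarrow> ereal (c * g n) \<le> ereal_of_enat (G n 1 1)"
    and "\<And>n. F n = (SUP h\<in>{1..n}. SUP w\<in>{1..n}. G n h w)"
  shows "is_Omega (\<lambda>n. enat (T n) * F n) g"
  unfolding is_Omega_def
\<comment> \<open>The threshold 1 ensures that the range \<open>{1..n}\<close> contains the
  parameter value 1.\<close>
proof (intro exI[of _ c] conjI assms(2) eventually_sequentiallyI[of 1])
  fix n :: nat assume n: "1 \<le> n"
  have "G n 1 1 \<le> F n"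
    unfolding assms(4) using n
    by (intro SUP_upper2[of 1 "{1..n}" "G n 1 1"] SUP_upper) auto
  also have "F n \<le> enat (T n) * F n"
    using mult_right_mono[of 1 "enat (T n)" "F n"] assms(1)[of n]
    by (simp add: enat_ord_simps(1)[of 1, folded one_enat_def])
  finally show "ereal (c * g n) \<le> ereal_of_enat (enat (T n) * F n)"
    using assms(3)[of n] n by (meson ereal_of_enat_le_iff order.trans less_le_trans zero_less_one)
qed

theorem theorem9:
  fixes T_f :: "nat \<Rightarrow> nat"
  assumes "\<And>n. 1 \<le> T_f n"
    and "(\<lambda>n. real (T_f n)) \<in> O(\<lambda>_. 1)"
  shows "is_Omega (\<lambda>n. enat (T_f n) * LREC2_det n) (\<lambda>n. (real n)\<^sup>2) \<and>
    is_Omega (\<lambda>n. enat (T_f n) * LREC2_rand n) (\<lambda>n. (real n)\<^sup>2) \<and>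
    is_Omega (\<lambda>n. enat (T_f n) * LREC2_quantum n) (\<lambda>n. real n)"
proof (intro conjI)
  have "ereal ((real n)\<^sup>2 / 3) \<le>
      ereal_of_enat (det_query_complexity n (LREC2_promise n) (LREC2_correct n 1 1))" for n
    using LREC2_rand_lower[of n]
    by (rule order.trans) (simp add: rand_le_det_query_complexity)
  then show "is_Omega (\<lambda>n. enat (T_f n) * LREC2_det n) (\<lambda>n. (real n)\<^sup>2)"
    by (intro is_OmegaI[OF assms(1) _ _ LREC2_det_def, of "1 / 3"]) auto
  show "is_Omega (\<lambda>n. enat (T_f n) * LREC2_rand n) (\<lambda>n. (real n)\<^sup>2)"
    using LREC2_rand_lower
    by (intro is_OmegaI[OF assms(1) _ _ LREC2_rand_def, of "1 / 3"]) auto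
  show "is_Omega (\<lambda>n. enat (T_f n) * LREC2_quantum n) (\<lambda>n. real n)"
    using LREC2_quantum_lower
    by (intro is_OmegaI[OF assms(1) _ _ LREC2_quantum_def, of "1 / 10"]) auto
qed

end
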